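(* Let $N\ge 1$ be an integer and $\rho>1$. Assume that $u$ is analytic on $[-1,1]$ and can be extended analytically to the closed region bounded by the ellipse $E_\rho$ (including $E_\rho$ itself). Let $u_N$ be the polynomial of degree at most $N$ that interpolates $u$ at the $N+1$ zeros of $T_{N+1}$ on $[-1,1]$. Then $$\max_{x\in[-1,1]} |u(x) - u_N(x) | \le \frac{C_\rho(u) L_\rho}{\pi D_\rho} \frac{1}{\rho^{N+1}-\rho^{-N-1}},$$ $$\max_{x\in[-1,1]} |u'(x)-u_N'(x) | \le \frac{C_\rho(u) L_\rho}{\pi D_\rho}\left( (N+1)^2 + \frac{1}{D_\rho} \right) \frac{1}{\rho^{N+1}-\rho^{-N-1}},$$ $$\max_{x\in[-1,1]} |u''(x) - u_N''(x)| \le \frac{C_\rho(u) L_\rho}{\pi}\left( \frac{N(N+1)^2(N+2)}{3D_\rho} + \frac{2(N+1)^2}{D_\rho^2} + \frac{2}{D_\rho^3}\right) \frac{1}{\rho^{N+1}-\rho^{-N-1}}.$$ Furthermore, at the points $t_j=\cos\frac{j\pi}{N+1}$, $j=1,\dots,N$, which are the zeros of $T_{N+1}'$, $$\max_{1\le j\le N} |u'(t_j)-u_N'(t_j) | \le \frac{C_\rho(u) L_\rho}{\pi D_\rho^2}\,\frac{1}{\rho^{N+1}-\rho^{-N-1}},$$ and at the zeros $\tau_1,\dots,\tau_{N-1}$ of $T_{N+1}''$, which are $\tau_j=\cos\theta_j$ with $\theta_j\in(0,\pi)$ satisfying $(N+1)\cos((N+1)\theta)\sin\theta=\sin((N+1)\theta)\cos\theta$,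 for every $1\le j\le N-1$, $$|u''(\tau_j) - u_N''(\tau_j)| \le \frac {2C_\rho(u) L_\rho}{\pi D_\rho^2}\left( (N+1)^2 + \frac{1}{D_\rho} \right) \frac{1}{\rho^{N+1}-\rho^{-N-1}}.$$
   Context: $T_n$ is the Chebyshev polynomial of the first kind, $T_n(\cos\theta)=\cos n\theta$. For $\rho>1$, $E_\rho=\{\frac12(\rho e^{i\theta}+\rho^{-1}e^{-i\theta}):0\le\theta\le 2\pi\}\subset\mathbb{C}$ is the ellipse with foci $\pm1$ whose semi-axes sum to $\rho$. The analytic extension of $u$ is still denoted $u$. Constants: $C_\rho(u)=\max_{z\in E_\rho}|u(z)|$; $D_\rho=\frac12(\rho+\rho^{-1})-1$, the shortest distance from $E_\rho$ to $[-1,1]$; $L_\rho$ is the arc length of $E_\rho$. *)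

theory Defs
  imports "HOL-Analysis.Analysis" "HOL-Computational_Algebra.Polynomial"
begin

definition chebyshev_T :: "nat \<Rightarrow> real poly" where
  "chebyshev_T n = (THE p. \<forall>\<theta>. poly p (cos \<theta>) = cos (real n * \<theta>))"

lemma chebyshev_T_exists:
  "\<exists>p :: real poly. \<forall>\<theta>. poly p (cos \<theta>) = cos (real n * \<theta>)"
proof (induction n rule: induct_nat_012)
  case 0
  show ?case by (rule exI[of _ 1]) simp
next
  case 1
  show ?case by (rule exI[of _ "[:0, 1:]"]) simp
next
  case (ge2 n)
  then obtain p q :: "real poly"
    where p: "\<And>\<theta>. poly p (cos \<theta>) = cos (real n * \<theta>)"
      and q: "\<And>\<theta>. poly q (cos \<theta>) = cos (real (Suc n) * \<theta>)"
    by blast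
  have "poly ([:0, 2:] * q - p) (cos \<theta>) = cos (real (Suc (Suc n)) * \<theta>)" for \<theta>
  proof -
    have "cos (real (Suc n) * \<theta> + \<theta>) + cos (real (Suc n) * \<theta> - \<theta>)
        = 2 * cos \<theta> * cos (real (Suc n) * \<theta>)"
      by (simp add: cos_add cos_diff)
    moreover have "real (Suc n) * \<theta> + \<theta> = real (Suc (Suc n)) * \<theta>"
      and "real (Suc n) * \<theta> - \<theta> = real n * \<theta>"
      by (simp_all add: algebra_simps)
    ultimately show ?thesis by (simp add: p q)
  qed
  then show ?case by blast
qed

lemma chebyshev_T_cos: "poly (chebyshev_T n) (cos \<theta>) = cos (real n * \<theta>)"
proof -
  have "\<exists>!p :: real poly. \<forall>\<theta>. poly p (cos \<theta>) = cos (real n * \<theta>)"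
  proof (rule ex_ex1I[OF chebyshev_T_exists])
    fix p q :: "real poly"
    assume p: "\<forall>\<theta>. poly p (cos \<theta>) = cos (real n * \<theta>)"
      and q: "\<forall>\<theta>. poly q (cos \<theta>) = cos (real n * \<theta>)"
    have "poly (p - q) x = 0" if "x \<in> {-1..1}" for x
      using p[rule_format, of "arccos x"] q[rule_format, of "arccos x"] that by simp
    then have "{-1..1} \<subseteq> {x. poly (p - q) x = 0}" by blast
    then have "infinite {x. poly (p - q) x = 0}"
      by (rule infinite_super) (simp add: infinite_Icc)
    then have "p - q = 0" using poly_roots_finite by blast
    then show "p = q" by simp
  qed
  from theI'[OF this] show ?thesis unfolding chebyshev_T_def by blast
qed

definition ellipse_point :: "real \<Rightarrow> real \<Rightarrow> complex" where
  "ellipse_point \<rho> \<theta> =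
     (of_real \<rho> * exp (\<i> * of_real \<theta>) + of_real (1 / \<rho>) * exp (- \<i> * of_real \<theta>)) / 2"

definition ellipse :: "real \<Rightarrow> complex set" where
  "ellipse \<rho> = ellipse_point \<rho> ` {0..2 * pi}"

definition ellipse_region :: "real \<Rightarrow> complex set" where
  "ellipse_region \<rho> = ellipse \<rho> \<union> inside (ellipse \<rho>)"

text \<open>The supremum below is a maximum for \<open>u\<close> continuous on the ellipse;
  see \<open>C_const_attained\<close>.\<close>

definition C_const :: "real \<Rightarrow> (complex \<Rightarrow> complex) \<Rightarrow> real" where
  "C_const \<rho> u = (SUP z\<in>ellipse \<rho>. cmod (u z))"

definition D_const :: "real \<Rightarrow> real" where
  "D_const \<rho> = (\<rho> + 1 / \<rho>) / 2 - 1"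

definition L_const :: "real \<Rightarrow> real" where
  "L_const \<rho> = integral {0..2 * pi} (\<lambda>\<theta>. norm (vector_derivative (ellipse_point \<rho>) (at \<theta>)))"

lemma C_const_attained:
  assumes "continuous_on (ellipse \<rho>) u"
  shows "\<exists>z\<in>ellipse \<rho>. C_const \<rho> u = cmod (u z) \<and> (\<forall>w\<in>ellipse \<rho>. cmod (u w) \<le> cmod (u z))"
proof -
  have "compact (ellipse \<rho>)"
    unfolding ellipse_def ellipse_point_def
    by (intro compact_continuous_image continuous_intros) auto
  moreover have "ellipse \<rho> \<noteq> {}" by (simp add: ellipse_def)
  moreover have "continuous_on (ellipse \<rho>) (\<lambda>z. cmod (u z))"
    using assms by (intro continuous_intros)
  ultimately obtain z where z: "z \<in> ellipse \<rho>" "\<And>w. w \<in> ellipse \<rho> \<Longrightarrow> cmod (u w) \<le> cmod (u z)"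
    using continuous_attains_sup by metis
  then have "C_const \<rho> u = cmod (u z)"
    unfolding C_const_def by (intro cSup_eq_maximum) auto
  with z show ?thesis by blast
qed

end

theory Submission
  imports Defs "HOL-Complex_Analysis.Complex_Analysis"
begin

text \<open>Hermite's formula writes the interpolation error as \<open>u - u\<^sub>N = T G\<^sub>1\<close>, where \<open>T = T\<^bsub>N+1\<^esub>\<close> and
  \<open>2 \<pi> i G\<^sub>k(x)\<close> is the integral of \<open>u(z) / (T(z) (z - x)\<^sup>k)\<close> over the ellipse. Since \<open>G\<^sub>k' = k G\<^bsub>k+1\<^esub>\<close>, the
  derivatives of the error are \<open>T' G\<^sub>1 + T G\<^sub>2\<close> and \<open>T'' G\<^sub>1 + 2 T' G\<^sub>2 + 2 T G\<^sub>3\<close>. On the ellipse the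
  Joukowsky parametrisation \<open>z = (w + 1/w)/2\<close>, \<open>T(z) = (w\<^bsup>N+1\<^esup> + 1/w\<^bsup>N+1\<^esup>)/2\<close> bounds \<open>\<bar>T\<bar>\<close> from below; on
  \<open>[-1,1]\<close> the recurrence \<open>T\<^bsub>n+2\<^esub>'/(n+2) = T\<^sub>n'/n + 2 T\<^bsub>n+1\<^esub>\<close> gives the extremal bounds for \<open>T'\<close> and \<open>T''\<close>
  by induction.\<close>

subsection \<open>Chebyshev polynomials\<close>

text \<open>Excluding \<open>sin \<theta> = 0\<close> lets identities for derivatives be proved by
  cancelling \<open>sin \<theta>\<close>. The remaining cosines still fill the open interval from -1
  to 1, and a nonzero polynomial has only finitely many roots.\<close>

lemma poly_eq_on_cosI:
  fixes p q :: "real poly"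
  assumes "\<And>\<theta>. sin \<theta> \<noteq> 0 \<Longrightarrow> poly p (cos \<theta>) = poly q (cos \<theta>)"
  shows "p = q"
proof -
  have "poly (p - q) x = 0" if "x \<in> {-1<..<1}" for x
  proof -
    have "sin (arccos x) > 0"
      using that by (intro sin_gt_zero arccos_lt_bounded[THEN conjunct1] arccos_lt_bounded[THEN conjunct2]) auto
    then show ?thesis using assms[of "arccos x"] that by simp
  qed
  then have "{-1<..<1} \<subseteq> {x. poly (p - q) x = 0}" by blast
  then have "infinite {x. poly (p - q) x = 0}"
    by (rule infinite_super) (simp add: infinite_Ioo)
  then show ?thesis using poly_roots_finite[of "p - q"] by auto
qed

lemma chebyshev_T_0: "chebyshev_T 0 = 1"
  by (rule poly_eq_on_cosI) (simp add: chebyshev_T_cos)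

lemma chebyshev_T_1: "chebyshev_T (Suc 0) = [:0, 1:]"
  by (rule poly_eq_on_cosI) (simp add: chebyshev_T_cos)

lemma chebyshev_T_Suc_Suc:
  "chebyshev_T (Suc (Suc n)) = [:0, 2:] * chebyshev_T (Suc n) - chebyshev_T n"
proof (rule poly_eq_on_cosI)
  fix \<theta> :: real
  have "cos (real (Suc n) * \<theta> + \<theta>) + cos (real (Suc n) * \<theta> - \<theta>)
      = 2 * cos \<theta> * cos (real (Suc n) * \<theta>)"
    by (simp add: cos_add cos_diff)
  moreover have "real (Suc n) * \<theta> + \<theta> = real (Suc (Suc n)) * \<theta>"
    and "real (Suc n) * \<theta> - \<theta> = real n * \<theta>"
    by (simp_all add: algebra_simps)
  ultimately show "poly (chebyshev_T (Suc (Suc n))) (cos \<theta>)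
      = poly ([:0, 2:] * chebyshev_T (Suc n) - chebyshev_T n) (cos \<theta>)"
    by (simp add: chebyshev_T_cos)
qed

lemma degree_chebyshev_T_le: "degree (chebyshev_T n) \<le> n"
proof (induction n rule: induct_nat_012)
  case (ge2 n)
  have "degree ([:0, 2:] * chebyshev_T (Suc n)) \<le> Suc (Suc n)"
    using degree_mult_le[of "[:0, 2:]" "chebyshev_T (Suc n)"] ge2 by simp
  then show ?case
    unfolding chebyshev_T_Suc_Suc using ge2 by (intro degree_diff_le) auto
qed (simp_all add: chebyshev_T_0 chebyshev_T_1)

lemma abs_chebyshev_T_le_1:
  assumes "x \<in> {-1..1}"
  shows "\<bar>poly (chebyshev_T n) x\<bar> \<le> 1"
  using chebyshev_T_cos[of n "arccos x"] assms by simp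

section \<open>Derivatives of Chebyshev polynomials and their size on [-1,1]\<close>

lemma pderiv_chebyshev_T_cos:
  "poly (pderiv (chebyshev_T n)) (cos \<theta>) * sin \<theta> = real n * sin (real n * \<theta>)"
proof -
  have "((\<lambda>\<theta>. poly (chebyshev_T n) (cos \<theta>)) has_real_derivative
      poly (pderiv (chebyshev_T n)) (cos \<theta>) * (- sin \<theta>)) (at \<theta>)"
    by (rule DERIV_chain2[OF poly_DERIV]) (auto intro!: derivative_eq_intros)
  moreover have "((\<lambda>\<theta>. cos (real n * \<theta>)) has_real_derivative
      - (real n * sin (real n * \<theta>))) (at \<theta>)"
    by (auto intro!: derivative_eq_intros)
  ultimately show ?thesis
    unfolding chebyshev_T_cos using DERIV_unique by fastforce
qed

text \<open>Differentiate \<open>pderiv_chebyshev_T_cos\<close> in \<theta>, multiply by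
  \<open>sin \<theta>\<close> and eliminate the first derivative with the same identity. The bracket
  on the right vanishes exactly under the equation that characterises the angles of the roots of
  T''.\<close>

lemma pderiv2_chebyshev_T_cos:
  "poly (pderiv (pderiv (chebyshev_T n))) (cos \<theta>) * sin \<theta> ^ 3
    = real n * (sin (real n * \<theta>) * cos \<theta> - real n * cos (real n * \<theta>) * sin \<theta>)"
proof -
  let ?p = "pderiv (chebyshev_T n)"
  have "((\<lambda>\<theta>. poly ?p (cos \<theta>)) has_real_derivative
      poly (pderiv ?p) (cos \<theta>) * (- sin \<theta>)) (at \<theta>)"
    by (rule DERIV_chain2[OF poly_DERIV]) (auto intro!: derivative_eq_intros)
  then have "((\<lambda>\<theta>. poly ?p (cos \<theta>) * sin \<theta>) has_real_derivative
      poly (pderiv ?p) (cos \<theta>) * (- sin \<theta>) * sin \<theta> + cos \<theta> * poly ?p (cos \<theta>)) (at \<theta>)"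
    using DERIV_mult[OF _ DERIV_sin, of "\<lambda>\<theta>. poly ?p (cos \<theta>)"] by (simp only: mult.commute[of _ "cos \<theta>"])
  moreover have "((\<lambda>\<theta>. real n * sin (real n * \<theta>)) has_real_derivative
      real n * (real n * cos (real n * \<theta>))) (at \<theta>)"
    by (auto intro!: derivative_eq_intros)
  ultimately have "poly (pderiv ?p) (cos \<theta>) * (- sin \<theta>) * sin \<theta> + cos \<theta> * poly ?p (cos \<theta>)
      = real n * (real n * cos (real n * \<theta>))"
    unfolding pderiv_chebyshev_T_cos by (rule DERIV_unique)
  then have "(poly (pderiv ?p) (cos \<theta>) * (- sin \<theta>) * sin \<theta> + cos \<theta> * poly ?p (cos \<theta>)) * sin \<theta>
      = real n * (real n * cos (real n * \<theta>)) * sin \<theta>" by simp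
  with pderiv_chebyshev_T_cos[of n \<theta>] show ?thesis by algebra
qed

text \<open>This is T_{n+2}'/(n+2) = T_n'/n + 2 T_{n+1} cleared of denominators. After
  multiplication by \<open>sin \<theta>\<close> it becomes sin((n+2)\<theta>) - sin(n\<theta>) = 2
  cos((n+1)\<theta>) sin \<theta>.\<close>

lemma pderiv_chebyshev_T_rec:
  "smult (real n) (pderiv (chebyshev_T (n + 2)))
    = smult (real n + 2) (pderiv (chebyshev_T n) + smult (2 * real n) (chebyshev_T (n + 1)))"
proof (rule poly_eq_on_cosI)
  fix \<theta> :: real assume s: "sin \<theta> \<noteq> 0"
  have a: "real (n + 2) * \<theta> = real (n + 1) * \<theta> + \<theta>" "real n * \<theta> = real (n + 1) * \<theta> - \<theta>"
    by (simp_all add: algebra_simps)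
  have "sin (real (n + 2) * \<theta>) = sin (real n * \<theta>) + 2 * cos (real (n + 1) * \<theta>) * sin \<theta>"
    unfolding a sin_add sin_diff by simp
  then have "real n * (poly (pderiv (chebyshev_T (n + 2))) (cos \<theta>) * sin \<theta>)
      = (real n + 2) * (poly (pderiv (chebyshev_T n)) (cos \<theta>) * sin \<theta>
          + 2 * real n * poly (chebyshev_T (n + 1)) (cos \<theta>) * sin \<theta>)"
    unfolding pderiv_chebyshev_T_cos chebyshev_T_cos by (simp add: algebra_simps)
  with s show "poly (smult (real n) (pderiv (chebyshev_T (n + 2)))) (cos \<theta>)
      = poly (smult (real n + 2) (pderiv (chebyshev_T n)
          + smult (2 * real n) (chebyshev_T (n + 1)))) (cos \<theta>)"
    by (simp flip: mult.assoc distrib_right)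
qed

lemma chebyshev_T_2: "chebyshev_T (Suc (Suc 0)) = [:-1, 0, 2:]"
  by (simp add: chebyshev_T_Suc_Suc chebyshev_T_0 chebyshev_T_1 one_pCons)

text \<open>The recurrence, the triangle inequality and |T_{m+1}| <= 1 carry the bound from m to
  m+2, since (m+2)(m^2 + 2m) = m(m+2)^2. The bound is the value of T_n' at 1.\<close>

lemma abs_pderiv_chebyshev_T_le:
  assumes x: "x \<in> {-1..1}"
  shows "\<bar>poly (pderiv (chebyshev_T n)) x\<bar> \<le> (real n)\<^sup>2"
proof -
  \<comment> \<open>The recurrence at index m determines T_{m+2}' only after division by m, so the
    induction runs over positive indices, with 1 and 2 as base cases.\<close>
  have "\<bar>poly (pderiv (chebyshev_T (Suc n))) x\<bar> \<le> (real (Suc n))\<^sup>2" for n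
  proof (induction n rule: induct_nat_012)
    case 0
    show ?case by (simp add: chebyshev_T_1 pderiv_pCons)
  next
    case 1
    have "\<bar>4 * x\<bar> \<le> 4" using x by auto
    then show ?case by (simp add: chebyshev_T_2 pderiv_pCons algebra_simps)
  next
    case (ge2 n)
    define m where "m = Suc n"
    let ?p = "\<lambda>k. poly (pderiv (chebyshev_T k)) x"
    have "real m * ?p (m + 2) = (real m + 2) * (?p m + 2 * real m * poly (chebyshev_T (m + 1)) x)"
      using arg_cong[OF pderiv_chebyshev_T_rec[of m], of "\<lambda>p. poly p x"] by simp
    then have "real m * \<bar>?p (m + 2)\<bar>
        = (real m + 2) * \<bar>?p m + 2 * real m * poly (chebyshev_T (m + 1)) x\<bar>"
      by (metis abs_mult abs_of_nat of_nat_add of_nat_numeral)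
    also have "\<dots> \<le> (real m + 2) * ((real m)\<^sup>2 + 2 * real m * 1)"
      using ge2(1) abs_chebyshev_T_le_1[OF x, of "m + 1"]
      by (intro mult_left_mono order_trans[OF abs_triangle_ineq] add_mono)
         (auto simp: m_def abs_mult intro!: mult_left_mono)
    finally have "real m * \<bar>?p (m + 2)\<bar> \<le> real m * (real m + 2)\<^sup>2"
      by (simp add: power2_eq_square algebra_simps)
    then show ?case by (simp add: m_def)
  qed
  from this[of "n - 1"] show ?thesis
    by (cases n) (simp_all add: chebyshev_T_0)
qed

text \<open>The same induction on the differentiated recurrence, with the bound (m+1)^2 for T_{m+1}'
  in place of 1. It closes because m(m^2-1)/3 + 2(m+1)^2 = (m+1)(m+2)(m+3)/3. The bound is the value
  of T_n'' at 1.\<close>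

lemma abs_pderiv2_chebyshev_T_le:
  assumes x: "x \<in> {-1..1}"
  shows "\<bar>poly (pderiv (pderiv (chebyshev_T n))) x\<bar> \<le> (real n)\<^sup>2 * ((real n)\<^sup>2 - 1) / 3"
proof -
  have "\<bar>poly (pderiv (pderiv (chebyshev_T (Suc n)))) x\<bar>
      \<le> (real (Suc n))\<^sup>2 * ((real (Suc n))\<^sup>2 - 1) / 3" for n
  proof (induction n rule: induct_nat_012)
    case 0
    show ?case by (simp add: chebyshev_T_1 pderiv_pCons)
  next
    case 1
    show ?case by (simp add: chebyshev_T_2 pderiv_pCons)
  next
    case (ge2 n)
    define m where "m = Suc n"
    let ?p = "\<lambda>k. poly (pderiv (pderiv (chebyshev_T k))) x"
    let ?q = "poly (pderiv (chebyshev_T (m + 1))) x"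
    have "real m * ?p (m + 2) = (real m + 2) * (?p m + 2 * real m * ?q)"
      using arg_cong[OF pderiv_chebyshev_T_rec[of m], of "\<lambda>p. poly (pderiv p) x"]
      by (simp add: pderiv_smult pderiv_add)
    then have "real m * \<bar>?p (m + 2)\<bar> = (real m + 2) * \<bar>?p m + 2 * real m * ?q\<bar>"
      by (metis abs_mult abs_of_nat of_nat_add of_nat_numeral)
    also have "\<dots> \<le> (real m + 2)
        * ((real m)\<^sup>2 * ((real m)\<^sup>2 - 1) / 3 + 2 * real m * (real (m + 1))\<^sup>2)"
      using ge2(1) abs_pderiv_chebyshev_T_le[OF x, of "m + 1"]
      by (intro mult_left_mono order_trans[OF abs_triangle_ineq] add_mono)
         (auto simp: m_def abs_mult intro!: mult_left_mono)
    finally have "real m * \<bar>?p (m + 2)\<bar>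
        \<le> real m * ((real m + 2)\<^sup>2 * ((real m + 2)\<^sup>2 - 1) / 3)"
      by (simp add: power2_eq_square field_simps)
    then have "\<bar>?p (m + 2)\<bar> \<le> (real m + 2)\<^sup>2 * ((real m + 2)\<^sup>2 - 1) / 3"
      by (rule mult_left_le_imp_le) (simp add: m_def)
    moreover have "Suc (Suc (Suc n)) = m + 2" "real (m + 2) = real m + 2" by (simp_all add: m_def)
    ultimately show ?case by (simp only:)
  qed
  note le = this
  show ?thesis
  proof (cases n)
    case 0
    then show ?thesis by (simp add: chebyshev_T_0)
  next
    case (Suc k)
    then show ?thesis using le[of k] by (simp only:)
  qed
qed

section \<open>Roots of T_n and of its first two derivatives\<close>

lemma chebyshev_T_roots_card:
  "n \<le> card {x \<in> {-1..1}. poly (chebyshev_T n) x = 0}"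
proof -
  \<comment> \<open>These angles make \<open>n * ?t j\<close> an odd multiple of pi/2. They lie in
    [0,pi], where the cosine is injective, so their cosines are distinct roots.\<close>
  let ?t = "\<lambda>j. (2 * real j + 1) * pi / (2 * real n)"
  have t: "0 \<le> ?t j" "?t j \<le> pi" if "j < n" for j
  proof -
    have "(2 * real j + 1) * pi \<le> (2 * real n) * pi"
      using that by (intro mult_right_mono) auto
    then show "?t j \<le> pi" using that by (simp add: field_simps)
  qed simp
  have "inj_on (\<lambda>j. cos (?t j)) {..<n}"
  proof (rule inj_onI)
    fix i j assume "i \<in> {..<n}" "j \<in> {..<n}" "cos (?t i) = cos (?t j)"
    then have "?t i = ?t j" using cos_inj_pi t by (metis lessThan_iff)
    then show "i = j" using \<open>i \<in> {..<n}\<close> by (simp add: field_simps)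
  qed
  then have "card ((\<lambda>j. cos (?t j)) ` {..<n}) = n" by (simp add: card_image)
  moreover have "(\<lambda>j. cos (?t j)) ` {..<n} \<subseteq> {x \<in> {-1..1}. poly (chebyshev_T n) x = 0}"
  proof clarsimp
    fix j assume "j < n"
    then have "real n * ?t j = real j * pi + pi / 2" by (simp add: field_simps)
    then show "poly (chebyshev_T n) (cos (?t j)) = 0"
      by (simp add: chebyshev_T_cos cos_add)
  qed
  moreover have "chebyshev_T n \<noteq> 0"
    using chebyshev_T_cos[of n 0] by auto
  then have "finite {x \<in> {-1..1}. poly (chebyshev_T n) x = 0}"
    using poly_roots_finite[of "chebyshev_T n"] by (auto intro: rev_finite_subset)
  ultimately show ?thesis
    using card_mono[of "{x \<in> {-1..1}. poly (chebyshev_T n) x = 0}" "(\<lambda>j. cos (?t j)) ` {..<n}"]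
    by (simp only:)
qed

text \<open>The n distinct roots force the degree up to n, so the leading coefficient need not be
  computed.\<close>

lemma degree_chebyshev_T: "degree (chebyshev_T n) = n"
proof (rule antisym[OF degree_chebyshev_T_le])
  have nz: "chebyshev_T n \<noteq> 0" using chebyshev_T_cos[of n 0] by auto
  have "n \<le> card {x \<in> {-1..1}. poly (chebyshev_T n) x = 0}"
    by (rule chebyshev_T_roots_card)
  also have "\<dots> \<le> card {x. poly (chebyshev_T n) x = 0}"
    by (intro card_mono poly_roots_finite nz) auto
  also have "\<dots> \<le> degree (chebyshev_T n)" by (rule card_poly_roots_bound[OF nz])
  finally show "n \<le> degree (chebyshev_T n)" .
qed

text \<open>At these angles sin((N+1)\<theta>) = 0 while sin \<theta> > 0, so their cosines are
  roots of T'. There are N of them and T' has degree N, which leaves room for no others.\<close>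

lemma bij_betw_roots_pderiv_chebyshev_T:
  "bij_betw (\<lambda>j. cos (real j * pi / (real N + 1))) {1..N}
     {x. poly (pderiv (chebyshev_T (N + 1))) x = 0}"
proof (cases "N = 0")
  case True
  then show ?thesis by (simp add: chebyshev_T_1 pderiv_pCons bij_betw_def)
next
  case False
  let ?t = "\<lambda>j. real j * pi / (real N + 1)"
  let ?p = "pderiv (chebyshev_T (N + 1))"
  have t: "0 < ?t j" "?t j < pi" if "j \<in> {1..N}" for j
  proof -
    have "real j * pi < (real N + 1) * pi" using that by (intro mult_strict_right_mono) auto
    then show "?t j < pi" by (simp add: field_simps)
  qed (use that in auto)
  have inj: "inj_on (\<lambda>j. cos (?t j)) {1..N}"
  proof (rule inj_onI)
    fix i j assume "i \<in> {1..N}" "j \<in> {1..N}" "cos (?t i) = cos (?t j)"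
    then have "?t i = ?t j" using cos_inj_pi t by (metis less_imp_le)
    then show "i = j" by (simp add: field_simps)
  qed
  have nz: "?p \<noteq> 0"
    unfolding pderiv_eq_0_iff degree_chebyshev_T by simp
  have sub: "(\<lambda>j. cos (?t j)) ` {1..N} \<subseteq> {x. poly ?p x = 0}"
  proof clarify
    fix j assume j: "j \<in> {1..N}"
    have "sin (?t j) > 0" using t[OF j] by (rule sin_gt_zero)
    moreover have "real (N + 1) * ?t j = real j * pi" by (simp add: field_simps)
    ultimately show "poly ?p (cos (?t j)) = 0"
      using pderiv_chebyshev_T_cos[of "N + 1" "?t j"] by simp
  qed
  have "card ((\<lambda>j. cos (?t j)) ` {1..N}) = N" using card_image[OF inj] by simp
  then have "card {x. poly ?p x = 0} \<le> card ((\<lambda>j. cos (?t j)) ` {1..N})"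
    using card_poly_roots_bound[OF nz] by (simp add: degree_pderiv degree_chebyshev_T)
  with sub have "(\<lambda>j. cos (?t j)) ` {1..N} = {x. poly ?p x = 0}"
    by (intro card_seteq poly_roots_finite nz) auto
  with inj show ?thesis by (simp add: bij_betw_def)
qed

text \<open>Rolle's theorem between the \<open>N\<close> consecutive roots of the first derivative already produces
  as many roots as the degree of the second derivative allows.\<close>

lemma roots_pderiv2_chebyshev_T:
  assumes "N \<ge> 1"
  defines "R \<equiv> {\<tau>. poly (pderiv (pderiv (chebyshev_T (N + 1)))) \<tau> = 0}"
  shows "card R = N - 1" and "R \<subseteq> {-1<..<1}"
proof -
  let ?t = "\<lambda>j. cos (real j * pi / (real N + 1))"
  let ?p = "pderiv (chebyshev_T (N + 1))"
  have nz: "pderiv ?p \<noteq> 0"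
    unfolding pderiv_eq_0_iff degree_pderiv degree_chebyshev_T using assms by simp
  have mono: "real i * pi / (real N + 1) < real j * pi / (real N + 1)" if "i < j" for i j
    using that by (intro divide_strict_right_mono mult_strict_right_mono) auto
  have le_pi: "real i * pi / (real N + 1) \<le> pi" if "i \<le> N + 1" for i
  proof -
    have "real i * pi \<le> (real N + 1) * pi" using that by (intro mult_right_mono) auto
    then show ?thesis by (simp add: field_simps)
  qed
  have t: "?t j < ?t i" if "i < j" "j \<le> N" for i j
    using that by (intro cos_monotone_0_pi mono le_pi) auto
  have t0: "poly ?p (?t j) = 0" if "j \<in> {1..N}" for j
    using bij_betw_roots_pderiv_chebyshev_T[of N] that by (auto simp: bij_betw_def)
  have "\<exists>x. ?t (Suc j) < x \<and> x < ?t j \<and> poly (pderiv ?p) x = 0" if j: "j \<in> {1..<N}" for j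
  proof -
    obtain x where x: "?t (Suc j) < x" "x < ?t j"
        "poly ?p (?t j) - poly ?p (?t (Suc j)) = (?t j - ?t (Suc j)) * poly (pderiv ?p) x"
      using poly_MVT[OF t[of j "Suc j"], of ?p] j by auto
    have "poly ?p (?t j) = 0" "poly ?p (?t (Suc j)) = 0" using t0[of j] t0[of "Suc j"] j by simp_all
    then have "poly (pderiv ?p) x = 0" using x by simp
    with x show ?thesis by blast
  qed
  then obtain x where x: "\<And>j. j \<in> {1..<N} \<Longrightarrow>
      ?t (Suc j) < x j \<and> x j < ?t j \<and> poly (pderiv ?p) (x j) = 0" by metis
  \<comment> \<open>The intervals between consecutive nodes are disjoint and move left as the index
    grows, so the N-1 points from Rolle's theorem are distinct.\<close>
  have lt: "x j < x i" if "i < j" "i \<in> {1..<N}" "j \<in> {1..<N}" for i j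
  proof -
    have "x j < ?t j" using x that by blast
    also have "\<dots> \<le> ?t (Suc i)"
      using t[of "Suc i" j] that by (cases "Suc i = j") auto
    also have "\<dots> < x i" using x that by blast
    finally show ?thesis .
  qed
  have inj: "inj_on x {1..<N}"
    using lt by (metis inj_onI less_irrefl linorder_neqE_nat)
  have sub: "x ` {1..<N} \<subseteq> R" using x by (auto simp: R_def)
  have card: "card (x ` {1..<N}) = N - 1" using card_image[OF inj] by simp
  then have "card R \<le> card (x ` {1..<N})"
    using card_poly_roots_bound[OF nz] by (simp add: R_def degree_pderiv degree_chebyshev_T)
  with sub have R: "R = x ` {1..<N}"
    unfolding R_def by (intro card_seteq[symmetric] poly_roots_finite nz) auto
  show "card R = N - 1" unfolding R by (rule card)
  have "x j \<in> {-1<..<1}" if "j \<in> {1..<N}" for j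
    using x[OF that] cos_le_one[of "real j * pi / (real N + 1)"]
      cos_ge_minus_one[of "real (Suc j) * pi / (real N + 1)"]
    by (simp only: greaterThanLessThan_iff) linarith
  then show "R \<subseteq> {-1<..<1}" unfolding R by blast
qed

text \<open>The trigonometric formula for T'' speaks only of arguments \<open>cos \<theta>\<close>.
  All roots lie strictly between -1 and 1, hence each is the cosine of an angle in (0,pi), where
  sin^3 \<theta> can be cancelled.\<close>

lemma roots_pderiv2_chebyshev_T_eq:
  assumes "N \<ge> 1"
  shows "{\<tau>. poly (pderiv (pderiv (chebyshev_T (N + 1)))) \<tau> = 0}
    = cos ` {\<theta>. 0 < \<theta> \<and> \<theta> < pi \<and>
        (real N + 1) * cos ((real N + 1) * \<theta>) * sin \<theta> = sin ((real N + 1) * \<theta>) * cos \<theta>}"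
    (is "?R = cos ` ?S")
proof -
  have iff: "poly (pderiv (pderiv (chebyshev_T (N + 1)))) (cos \<theta>) = 0 \<longleftrightarrow>
      (real N + 1) * cos ((real N + 1) * \<theta>) * sin \<theta> = sin ((real N + 1) * \<theta>) * cos \<theta>"
    if "0 < \<theta>" "\<theta> < pi" for \<theta>
  proof -
    have "sin \<theta> ^ 3 \<noteq> 0" using sin_gt_zero[OF that] by simp
    then have "poly (pderiv (pderiv (chebyshev_T (N + 1)))) (cos \<theta>) = 0 \<longleftrightarrow>
        poly (pderiv (pderiv (chebyshev_T (N + 1)))) (cos \<theta>) * sin \<theta> ^ 3 = 0" by simp
    then show ?thesis unfolding pderiv2_chebyshev_T_cos by (auto simp: add.commute)
  qed
  have "x \<in> cos ` ?S" if "x \<in> ?R" for x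
  proof -
    have "x \<in> {-1<..<1}" using roots_pderiv2_chebyshev_T(2)[OF assms] that by blast
    then have "x = cos (arccos x)" "0 < arccos x" "arccos x < pi"
      using arccos_lt_bounded[of x] by auto
    with that iff[of "arccos x"] show ?thesis by auto
  qed
  with iff show ?thesis by auto
qed

subsection \<open>The filled ellipse and contour integrals over its boundary\<close>

text \<open>On the unit circle \<open>cnj w\<close> equals 1/w, so there this is the Joukowsky map
  at \<open>\<rho> * w\<close>. With \<open>cnj w\<close> in place of 1/w the map is real-linear,
  which makes the filled ellipse a linear image of the disc.\<close>

definition ellipse_map :: "real \<Rightarrow> complex \<Rightarrow> complex" where
  "ellipse_map \<rho> w = (of_real \<rho> * w + of_real (1 / \<rho>) * cnj w) / 2"

lemma linear_ellipse_map: "linear (ellipse_map \<rho>)"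
  by (rule linearI) (simp_all add: ellipse_map_def algebra_simps add_divide_distrib scaleR_conv_of_real)

lemma continuous_on_ellipse_map [continuous_intros]:
  "continuous_on S f \<Longrightarrow> continuous_on S (\<lambda>x. ellipse_map \<rho> (f x))"
  unfolding ellipse_map_def by (intro continuous_intros) auto

text \<open>A kernel element w satisfies \<rho> |w| = |w| / \<rho>, which forces w = 0 because
  \<rho> > 1.\<close>

lemma inj_ellipse_map:
  assumes "\<rho> > 1"
  shows "inj (ellipse_map \<rho>)"
proof -
  have "w = 0" if "ellipse_map \<rho> w = 0" for w
  proof -
    have "of_real \<rho> * w = - (of_real (1 / \<rho>) * cnj w)"
      using that by (simp add: ellipse_map_def add_eq_0_iff2)
    then have "cmod (of_real \<rho> * w) = cmod (of_real (1 / \<rho>) * cnj w)"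
      by (metis norm_minus_cancel)
    then have "\<rho> * cmod w = 1 / \<rho> * cmod w" using assms by (simp add: norm_mult norm_divide)
    moreover have "\<rho> > 1 / \<rho>" using assms less_1_mult[of \<rho> \<rho>] by (simp add: divide_less_eq)
    ultimately have "cmod w = 0" by (metis mult_right_cancel less_irrefl)
    then show ?thesis by simp
  qed
  then show ?thesis using linear_injective_0[OF linear_ellipse_map] by blast
qed

lemma ellipse_point_eq: "ellipse_point \<rho> \<theta> = ellipse_map \<rho> (cis \<theta>)"
  by (simp add: ellipse_point_def ellipse_map_def cis_conv_exp exp_cnj)

lemma cis_image: "cis ` {0..2 * pi} = sphere 0 1"
proof (intro equalityI subsetI)
  fix z :: complex assume "z \<in> sphere 0 1"
  then have "(Re z)\<^sup>2 + (Im z)\<^sup>2 = 1" by (simp add: cmod_def)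
  then obtain t where "0 \<le> t" "t < 2 * pi" "Re z = cos t" "Im z = sin t"
    by (rule sincos_total_2pi)
  then show "z \<in> cis ` {0..2 * pi}" by (intro image_eqI[of _ _ t] complex_eqI) auto
qed auto

lemma ellipse_eq: "ellipse \<rho> = ellipse_map \<rho> ` sphere 0 1"
  unfolding ellipse_def by (simp add: ellipse_point_eq image_image flip: cis_image)

text \<open>An injective linear map carries the open disc to the interior of the image of the closed
  disc, so the ellipse is the frontier of a compact convex set. For such a set the inside of the
  frontier is the interior.\<close>

lemma ellipse_region_props:
  assumes "\<rho> > 1"
  shows inside_ellipse_eq: "inside (ellipse \<rho>) = interior (ellipse_region \<rho>)"
    and convex_ellipse_region: "convex (ellipse_region \<rho>)"
    and interior_ellipse_region_eq: "interior (ellipse_region \<rho>) = ellipse_map \<rho> ` ball 0 1"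
proof -
  let ?A = "ellipse_map \<rho>"
  note lin = linear_ellipse_map[of \<rho>] and inj = inj_ellipse_map[OF assms]
  have int: "interior (?A ` cball 0 1) = ?A ` ball 0 1"
    by (simp add: interior_injective_linear_image[OF lin inj])
  have comp: "compact (?A ` cball 0 1)"
    by (intro compact_continuous_image continuous_intros compact_cball)
  have "sphere 0 1 = cball 0 1 - ball (0::complex) 1" by auto
  then have "ellipse \<rho> = ?A ` cball 0 1 - ?A ` ball 0 1"
    unfolding ellipse_eq using inj by (metis image_set_diff)
  also have "\<dots> = frontier (?A ` cball 0 1)"
    unfolding frontier_def int using comp by (simp add: compact_imp_closed)
  finally have fr: "ellipse \<rho> = frontier (?A ` cball 0 1)" .
  have conv: "convex (?A ` cball 0 1)" by (intro convex_linear_image lin convex_cball)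
  have ins: "inside (ellipse \<rho>) = interior (?A ` cball 0 1)"
    unfolding fr using comp conv by (intro inside_frontier_eq_interior compact_imp_bounded)
  have "sphere 0 1 \<union> ball 0 1 = cball (0::complex) 1" by auto
  then have eq: "ellipse_region \<rho> = ?A ` cball 0 1"
    unfolding ellipse_region_def ins int unfolding ellipse_eq by (metis image_Un)
  show "inside (ellipse \<rho>) = interior (ellipse_region \<rho>)" "convex (ellipse_region \<rho>)"
    "interior (ellipse_region \<rho>) = ?A ` ball 0 1"
    unfolding eq using ins conv int by auto
qed

lemma ellipse_disjoint_interior:
  assumes "\<rho> > 1"
  shows "ellipse \<rho> \<inter> interior (ellipse_region \<rho>) = {}"
  using inside_ellipse_eq[OF assms] inside_no_overlap[of "ellipse \<rho>"] by auto

lemma ellipse_map_cis: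
  "ellipse_map \<rho> (cis \<theta>) = Complex ((\<rho> + 1 / \<rho>) / 2 * cos \<theta>) ((\<rho> - 1 / \<rho>) / 2 * sin \<theta>)"
  by (simp add: ellipse_map_def complex_eq_iff algebra_simps add_divide_distrib diff_divide_distrib)

lemma real_in_interior_ellipse_region:
  assumes "\<rho> > 1" "x \<in> {-1..1::real}"
  shows "complex_of_real x \<in> interior (ellipse_region \<rho>)"
proof -
  have a: "\<rho> + 1 / \<rho> > 2"
  proof -
    have "(\<rho> - 1)\<^sup>2 > 0" using assms by simp
    then show ?thesis using assms by (simp add: power2_eq_square field_simps)
  qed
  \<comment> \<open>The preimage of x under \<open>ellipse_map\<close> restricted to the real axis,
    where that map is multiplication by (\<rho> + 1/\<rho>)/2 > 1.\<close>
  define w where "w = 2 * x / (\<rho> + 1 / \<rho>)"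
  have "\<bar>2 * x\<bar> < \<rho> + 1 / \<rho>" using assms a by auto
  then have "\<bar>w\<bar> < 1" unfolding w_def abs_divide using a by simp
  moreover have "ellipse_map \<rho> (of_real w) = of_real (w * (\<rho> + 1 / \<rho>) / 2)"
    by (simp add: ellipse_map_def algebra_simps)
  then have "ellipse_map \<rho> (of_real w) = of_real x"
    using a by (simp add: w_def)
  ultimately show ?thesis
    unfolding interior_ellipse_region_eq[OF assms(1)] by (intro image_eqI[of _ _ "of_real w"]) auto
qed

lemma D_const_pos:
  assumes "\<rho> > 1"
  shows "D_const \<rho> > 0"
proof -
  have "(\<rho> - 1)\<^sup>2 > 0" using assms by simp
  then show ?thesis using assms by (simp add: D_const_def power2_eq_square field_simps)
qed

text \<open>With \<open>a = (\<rho> + 1 / \<rho>) / 2\<close> and \<open>c = cos \<theta>\<close> the difference of the squares is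
  \<open>(c - x)\<^sup>2 + 2 * (a - 1) * (1 - c * x)\<close>.\<close>

lemma dist_ellipse_real_ge:
  assumes "\<rho> > 1" "x \<in> {-1..1::real}" "z \<in> ellipse \<rho>"
  shows "D_const \<rho> \<le> cmod (z - of_real x)"
proof -
  obtain \<theta> where z: "z = ellipse_map \<rho> (cis \<theta>)"
    using assms(3) by (auto simp: ellipse_def ellipse_point_eq)
  define a b where "a = (\<rho> + 1 / \<rho>) / 2" and "b = (\<rho> - 1 / \<rho>) / 2"
  \<comment> \<open>The semi-axes are a and b, and the foci sit at distance 1 from the
    centre.\<close>
  have ab: "b\<^sup>2 = a\<^sup>2 - 1"
    using assms by (simp add: a_def b_def power2_eq_square field_simps)
  have a: "a > 1" using D_const_pos[OF assms(1)] by (simp add: a_def D_const_def)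
  have s: "(sin \<theta>)\<^sup>2 = 1 - (cos \<theta>)\<^sup>2" by (simp add: sin_squared_eq)
  have "\<bar>cos \<theta> * x\<bar> \<le> 1 * 1" unfolding abs_mult using assms by (intro mult_mono) auto
  then have "0 \<le> (cos \<theta> - x)\<^sup>2 + 2 * (a - 1) * (1 - cos \<theta> * x)" using a by auto
  also have "\<dots> = (a * cos \<theta> - x)\<^sup>2 + b\<^sup>2 * (sin \<theta>)\<^sup>2 - (a - 1)\<^sup>2"
    unfolding ab s by (simp add: power2_eq_square algebra_simps)
  finally have "(a - 1)\<^sup>2 \<le> (a * cos \<theta> - x)\<^sup>2 + (b * sin \<theta>)\<^sup>2"
    by (simp add: power_mult_distrib)
  also have "\<dots> = (cmod (z - of_real x))\<^sup>2"
    unfolding z ellipse_map_cis cmod_power2 by (simp add: a_def b_def)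
  finally show ?thesis unfolding D_const_def a_def by (rule power2_le_imp_le) simp
qed

section \<open>The ellipse as a contour: length estimate and winding number\<close>

definition ellipse_path :: "real \<Rightarrow> real \<Rightarrow> complex" where
  "ellipse_path \<rho> t = ellipse_point \<rho> (2 * pi * t)"

lemma has_vector_derivative_ellipse_point:
  "(ellipse_point \<rho> has_vector_derivative ellipse_map \<rho> (\<i> * cis \<theta>)) (at \<theta>)"
proof -
  have "(cis has_vector_derivative \<i> * cis \<theta>) (at \<theta>)"
    unfolding cis_conv_exp[abs_def]
    by (auto intro!: derivative_eq_intros has_vector_derivative_real_field)
  then have "((\<lambda>\<theta>. ellipse_map \<rho> (cis \<theta>)) has_vector_derivative ellipse_map \<rho> (\<i> * cis \<theta>)) (at \<theta>)"
    by (rule bounded_linear.has_vector_derivative[OF linear_conv_bounded_linear[THEN iffD1, OF linear_ellipse_map]])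
  then show ?thesis by (simp add: ellipse_point_eq[abs_def])
qed

lemma has_vector_derivative_ellipse_path:
  "(ellipse_path \<rho> has_vector_derivative (2 * pi) *\<^sub>R ellipse_map \<rho> (\<i> * cis (2 * pi * t))) (at t)"
proof -
  have "((\<lambda>t. 2 * pi * t) has_vector_derivative 2 * pi) (at t)"
    by (auto intro!: derivative_eq_intros)
  from vector_diff_chain_at[OF this has_vector_derivative_ellipse_point]
  show ?thesis by (simp add: o_def ellipse_path_def[abs_def])
qed

lemmas vector_derivative_ellipse_path = vector_derivative_at[OF has_vector_derivative_ellipse_path]

lemma valid_path_ellipse_path: "valid_path (ellipse_path \<rho>)"
  unfolding valid_path_def
proof (rule C1_differentiable_imp_piecewise)
  have "continuous_on {0..1} (\<lambda>t. (2 * pi) *\<^sub>R ellipse_map \<rho> (\<i> * cis (2 * pi * t)))"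
    by (intro continuous_intros)
  then show "ellipse_path \<rho> C1_differentiable_on {0..1}"
    unfolding C1_differentiable_on_def
    by (intro exI[of _ "\<lambda>t. (2 * pi) *\<^sub>R ellipse_map \<rho> (\<i> * cis (2 * pi * t))"]
        conjI ballI has_vector_derivative_ellipse_path)
qed

lemma ellipse_path_loop: "pathfinish (ellipse_path \<rho>) = pathstart (ellipse_path \<rho>)"
  by (simp add: pathfinish_def pathstart_def ellipse_path_def ellipse_point_eq)

lemma path_image_ellipse_path: "path_image (ellipse_path \<rho>) = ellipse \<rho>"
proof -
  have "(\<lambda>t. 2 * pi * t) ` {0..1::real} = {0..2 * pi}"
    by (simp add: image_mult_atLeastAtMost)
  then show ?thesis
    unfolding path_image_def ellipse_def ellipse_path_def[abs_def] by (metis image_image)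
qed

lemma contour_integrable_ellipse_path:
  assumes "continuous_on (ellipse \<rho>) f"
  shows "f contour_integrable_on ellipse_path \<rho>"
proof -
  have "continuous_on {0..1} (\<lambda>t. f (ellipse_path \<rho> t))"
    using continuous_on_compose2[OF assms, of "{0..1}" "ellipse_path \<rho>"]
      valid_path_imp_path[OF valid_path_ellipse_path] path_image_ellipse_path
    by (auto simp: path_def path_image_def)
  then show ?thesis
    unfolding contour_integrable_on vector_derivative_ellipse_path
    by (intro integrable_continuous_real continuous_intros)
qed

lemma norm_contour_integral_ellipse_le:
  assumes "continuous_on (ellipse \<rho>) f" and B: "\<And>z. z \<in> ellipse \<rho> \<Longrightarrow> cmod (f z) \<le> B"
  shows "cmod (contour_integral (ellipse_path \<rho>) f) \<le> B * L_const \<rho>"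
proof -
  let ?g = "\<lambda>\<theta>. cmod (ellipse_map \<rho> (\<i> * cis \<theta>))"
  have L: "L_const \<rho> = integral {0..2 * pi} ?g"
    unfolding L_const_def by (simp add: vector_derivative_at[OF has_vector_derivative_ellipse_point])
  \<comment> \<open>The arc length is an integral over [0,2 pi], whereas contour integrals run over
    [0,1]; the substitution \<theta> = 2 pi t matches the two.\<close>
  have "((\<lambda>t. (2 * pi) *\<^sub>R ?g (2 * pi * t)) has_integral integral {2 * pi * 0..2 * pi * 1} ?g) {0..1}"
    by (rule has_integral_substitution[where c = 0 and d = "2 * pi"])
       (auto intro!: continuous_intros derivative_eq_intros)
  then have I: "((\<lambda>t. B * (2 * pi * ?g (2 * pi * t))) has_integral B * L_const \<rho>) {0..1}"
    unfolding L by (intro has_integral_mult_right) simp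
  have "(\<lambda>t. f (ellipse_path \<rho> t) * vector_derivative (ellipse_path \<rho>) (at t)) integrable_on {0..1}"
    using contour_integrable_ellipse_path[OF assms(1)] by (simp add: contour_integrable_on)
  then have "cmod (contour_integral (ellipse_path \<rho>) f)
      \<le> integral {0..1} (\<lambda>t. B * (2 * pi * ?g (2 * pi * t)))"
    unfolding contour_integral_integral
  proof (rule integral_norm_bound_integral)
    show "(\<lambda>t. B * (2 * pi * ?g (2 * pi * t))) integrable_on {0..1}" using I by blast
    fix t :: real assume "t \<in> {0..1}"
    then have "ellipse_path \<rho> t \<in> ellipse \<rho>"
      unfolding path_image_ellipse_path[symmetric] path_image_def by blast
    from B[OF this]
    have "cmod (f (ellipse_path \<rho> t)) * (2 * pi * ?g (2 * pi * t)) \<le> B * (2 * pi * ?g (2 * pi * t))"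
      by (intro mult_right_mono) auto
    then show "cmod (f (ellipse_path \<rho> t) * vector_derivative (ellipse_path \<rho>) (at t))
        \<le> B * (2 * pi * ?g (2 * pi * t))"
      by (simp add: vector_derivative_ellipse_path norm_mult)
  qed
  then show ?thesis unfolding integral_unique[OF I] .
qed

text \<open>The winding number is constant on the connected interior, so it can be computed at the
  centre 0. There the ellipse deforms along segments to the circle of radius \<rho>/2 without
  meeting 0, since the two curves differ by a term of modulus only 1/(2\<rho>).\<close>

lemma winding_number_ellipse_path:
  assumes "\<rho> > 1" and x: "x \<in> interior (ellipse_region \<rho>)"
  shows "winding_number (ellipse_path \<rho>) x = 1"
proof -
  have path: "path (ellipse_path \<rho>)" by (rule valid_path_imp_path[OF valid_path_ellipse_path])
  have "winding_number (ellipse_path \<rho>) x = winding_number (ellipse_path \<rho>) 0"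
    using path ellipse_path_loop x real_in_interior_ellipse_region[OF assms(1), of 0]
      ellipse_disjoint_interior[OF assms(1)] convex_ellipse_region[OF assms(1)]
    by (intro winding_number_eq[where S = "interior (ellipse_region \<rho>)"])
       (auto simp: path_image_ellipse_path intro!: convex_connected convex_interior)
  also have "\<dots> = winding_number (circlepath 0 (\<rho> / 2)) 0"
  proof (rule winding_number_loops_linear_eq)
    fix t :: real
    define w where "w = cis (2 * pi * t)"
    have c: "circlepath 0 (\<rho> / 2) t = of_real (\<rho> / 2) * w"
      by (simp add: circlepath w_def cis_conv_exp mult_ac)
    have e: "ellipse_path \<rho> t = of_real (\<rho> / 2) * w + of_real (1 / (2 * \<rho>)) * cnj w"
      by (simp add: ellipse_path_def ellipse_point_eq ellipse_map_def w_def add_divide_distrib)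
    have w: "cmod w = 1" by (simp add: w_def)
    have lt: "1 / (2 * \<rho>) < \<rho> / 2" using assms(1) less_1_mult[of \<rho> \<rho>] by (simp add: field_simps)
    show "0 \<notin> closed_segment (circlepath 0 (\<rho> / 2) t) (ellipse_path \<rho> t)"
    proof
      assume "0 \<in> closed_segment (circlepath 0 (\<rho> / 2) t) (ellipse_path \<rho> t)"
      then obtain s where s: "0 \<le> s" "s \<le> 1"
        "0 = (1 - s) *\<^sub>R circlepath 0 (\<rho> / 2) t + s *\<^sub>R ellipse_path \<rho> t"
        by (auto simp: in_segment)
      have "of_real (\<rho> / 2) * w = - (of_real (s * (1 / (2 * \<rho>))) * cnj w)"
        using s(3) unfolding c e scaleR_conv_of_real
        by (subst eq_neg_iff_add_eq_0) (simp add: algebra_simps diff_divide_distrib)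
      then have "cmod (of_real (\<rho> / 2) * w) = cmod (of_real (s * (1 / (2 * \<rho>))) * cnj w)"
        by (metis norm_minus_cancel)
      then have "\<rho> / 2 = s * (1 / (2 * \<rho>))"
        unfolding norm_mult norm_of_real complex_mod_cnj w using s(1) assms(1) by simp
      also have "\<dots> \<le> 1 * (1 / (2 * \<rho>))" using s assms(1) by (intro mult_right_mono) auto
      finally show False using lt by simp
    qed
  qed (use path ellipse_path_loop in auto)
  also have "\<dots> = 1" using assms(1) by (intro winding_number_circlepath_centre) simp
  finally show ?thesis .
qed

subsection \<open>The interpolation remainder\<close>

lemma poly_map_poly_of_real:
  "poly (map_poly of_real p) (of_real x :: 'a :: {real_algebra_1, comm_ring_1}) = of_real (poly p x)"
  by (induction p) (simp_all add: map_poly_pCons)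

lemma pderiv_map_poly_of_real:
  "pderiv (map_poly of_real p :: 'a :: {real_algebra_1, idom} poly) = map_poly of_real (pderiv p)"
  by (rule poly_eqI) (simp add: coeff_pderiv coeff_map_poly)

text \<open>For z = (w + 1/w)/2 the right-hand side obeys the same three-term recurrence as T_n(z),
  with the same two initial values.\<close>

lemma chebyshev_T_joukowsky:
  assumes "w \<noteq> 0"
  shows "poly (map_poly complex_of_real (chebyshev_T n)) ((w + 1 / w) / 2) = (w ^ n + 1 / w ^ n) / 2"
proof (induction n rule: induct_nat_012)
  case 0
  show ?case by (simp add: chebyshev_T_0)
next
  case 1
  show ?case by (simp add: chebyshev_T_1 map_poly_pCons)
next
  case (ge2 n)
  have "map_poly complex_of_real (chebyshev_T (Suc (Suc n)))
      = [:0, 2:] * map_poly of_real (chebyshev_T (Suc n)) - map_poly of_real (chebyshev_T n)"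
    unfolding chebyshev_T_Suc_Suc
    by (rule poly_eqI) (simp add: coeff_map_poly coeff_pCons split: nat.split)
  then have rec: "poly (map_poly complex_of_real (chebyshev_T (Suc (Suc n)))) z
      = 2 * z * poly (map_poly of_real (chebyshev_T (Suc n))) z
        - poly (map_poly of_real (chebyshev_T n)) z" for z
    by (simp add: mult_ac)
  show ?case unfolding rec ge2 using assms by (simp add: field_simps)
qed

text \<open>Points of the ellipse have w of modulus \<rho>, so the two terms w^n and 1/w^n have
  moduli \<rho>^n and \<rho>^(-n); the reverse triangle inequality finishes. This is the source of
  the geometric factor in all the error bounds.\<close>

lemma norm_chebyshev_T_ellipse_ge:
  assumes "\<rho> > 1" "z \<in> ellipse \<rho>"
  shows "(\<rho> ^ n - 1 / \<rho> ^ n) / 2 \<le> cmod (poly (map_poly of_real (chebyshev_T n)) z)"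
proof -
  obtain \<theta> where z: "z = ellipse_map \<rho> (cis \<theta>)"
    using assms(2) by (auto simp: ellipse_def ellipse_point_eq)
  define w where "w = of_real \<rho> * cis \<theta>"
  have w: "cmod w = \<rho>" "w \<noteq> 0" using assms(1) by (auto simp: w_def norm_mult)
  have "1 / w = inverse (of_real \<rho>) * inverse (cis \<theta>)"
    by (simp only: w_def divide_inverse inverse_mult_distrib mult_1)
  also have "\<dots> = of_real (1 / \<rho>) * cnj (cis \<theta>)"
    by (simp only: cis_inverse cis_cnj divide_inverse of_real_inverse mult_1)
  finally have inv: "1 / w = of_real (1 / \<rho>) * cnj (cis \<theta>)" .
  have "z = (w + 1 / w) / 2"
    unfolding inv by (simp only: z ellipse_map_def w_def)
  then have eq: "poly (map_poly of_real (chebyshev_T n)) z = (w ^ n + 1 / w ^ n) / 2"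
    by (simp only: chebyshev_T_joukowsky[OF w(2)])
  have "cmod (w ^ n) - cmod (1 / w ^ n) \<le> cmod (w ^ n + 1 / w ^ n)"
    by (rule norm_diff_ineq)
  then show ?thesis unfolding eq by (simp add: norm_divide norm_power w)
qed

lemma has_field_derivative_cauchy_integral_ellipse:
  assumes "\<rho> > 1" and g: "continuous_on (ellipse \<rho>) g"
    and k: "k \<noteq> 0" and x: "x \<in> interior (ellipse_region \<rho>)"
  shows "((\<lambda>x. contour_integral (ellipse_path \<rho>) (\<lambda>z. g z / (z - x) ^ k)) has_field_derivative
    of_nat k * contour_integral (ellipse_path \<rho>) (\<lambda>z. g z / (z - x) ^ Suc k)) (at x)"
proof -
  let ?\<gamma> = "ellipse_path \<rho>" and ?S = "interior (ellipse_region \<rho>)"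
  \<comment> \<open>Differentiation under the integral by \<open>Cauchy_next_derivative\<close>
    requires the speed of the path to be bounded.\<close>
  have "continuous_on {0..1} (\<lambda>t. vector_derivative ?\<gamma> (at t))"
    unfolding vector_derivative_ellipse_path by (intro continuous_intros)
  then have "bounded ((\<lambda>t. vector_derivative ?\<gamma> (at t)) ` {0..1})"
    by (intro compact_imp_bounded compact_continuous_image) auto
  then obtain B where B: "\<And>t. t \<in> {0..1} \<Longrightarrow> norm (vector_derivative ?\<gamma> (at t)) \<le> B"
    unfolding bounded_iff by blast
  have x': "x \<in> ?S - path_image ?\<gamma>"
    using x ellipse_disjoint_interior[OF assms(1)] by (auto simp: path_image_ellipse_path)
  have int: "((\<lambda>z. g z / (z - w) ^ k) has_contour_integral
      contour_integral ?\<gamma> (\<lambda>z. g z / (z - w) ^ k)) ?\<gamma>" if "w \<in> ?S - path_image ?\<gamma>" for w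
    using that g
    by (intro has_contour_integral_integral contour_integrable_ellipse_path continuous_intros)
       (auto simp: path_image_ellipse_path)
  show ?thesis
    by (rule Cauchy_next_derivative(2)[OF _ B int k open_interior valid_path_ellipse_path x'])
       (use g in \<open>simp_all add: path_image_ellipse_path\<close>)
qed

text \<open>Hermite's remainder formula: \<open>(q z - q x) / (z - x)\<close> is a polynomial of degree at most \<open>N\<close> in
  \<open>x\<close>, so integrating it against \<open>u z / q z\<close> produces a polynomial, and by Cauchy's formula this
  polynomial agrees with \<open>u\<close> at the roots of \<open>q\<close>; hence it is the interpolant.\<close>

lemma interpolation_remainder:
  fixes P q :: "complex poly"
  assumes "\<rho> > 1" and u: "u holomorphic_on ellipse_region \<rho>"
    and degq: "degree q \<le> Suc N" and q: "\<And>z. z \<in> ellipse \<rho> \<Longrightarrow> poly q z \<noteq> 0"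
    and P: "degree P \<le> N"
    and A: "A \<subseteq> interior (ellipse_region \<rho>)" "card A > N"
    and root: "\<And>a. a \<in> A \<Longrightarrow> poly q a = 0" and interp: "\<And>a. a \<in> A \<Longrightarrow> poly P a = u a"
    and x: "x \<in> interior (ellipse_region \<rho>)"
  shows "u x - poly P x
    = poly q x * (contour_integral (ellipse_path \<rho>) (\<lambda>z. u z / poly q z / (z - x)) / (2 * pi * \<i>))"
proof -
  let ?\<gamma> = "ellipse_path \<rho>" and ?S = "interior (ellipse_region \<rho>)"
  have contu: "continuous_on (ellipse \<rho>) u"
    using holomorphic_on_imp_continuous_on[OF u]
    by (rule continuous_on_subset) (simp add: ellipse_region_def)
  \<comment> \<open>These are the coefficients of the divided difference: (q z - q y)/(z - y) is the
    sum of \<open>c j z * y ^ j\<close> over j <= N.\<close>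
  define c where "c = (\<lambda>j z. \<Sum>i=Suc j..Suc N. coeff q i * z ^ (i - j - 1))"
  define I where "I = (\<lambda>j. contour_integral ?\<gamma> (\<lambda>z. u z / poly q z * c j z))"
  define J where "J = (\<lambda>x. contour_integral ?\<gamma> (\<lambda>z. u z / poly q z / (z - x)))"
  define K where "K = (\<Sum>j<Suc N. monom (I j / (2 * pi * \<i>)) j)"
  have qsum: "poly q y = (\<Sum>i\<le>Suc N. coeff q i * y ^ i)" for y
    unfolding poly_altdef using degq
    by (intro sum.mono_neutral_left) (auto simp: coeff_eq_0)
  have K: "u y - poly K y = poly q y * (J y / (2 * pi * \<i>))" if y: "y \<in> ?S" for y
  proof -
    have ne: "z \<noteq> y" if "z \<in> ellipse \<rho>" for z
      using that y ellipse_disjoint_interior[OF assms(1)] by blast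
    have "((\<lambda>z. u z / (z - y)) has_contour_integral
        (2 * pi * \<i> * winding_number ?\<gamma> y * u y)) ?\<gamma>"
    proof (rule Cauchy_integral_formula_convex_simple[OF convex_ellipse_region[OF assms(1)] u y
          valid_path_ellipse_path _ ellipse_path_loop])
      show "path_image ?\<gamma> \<subseteq> ellipse_region \<rho> - {y}"
        using ne by (auto simp: path_image_ellipse_path ellipse_region_def)
    qed
    then have C: "((\<lambda>z. u z / (z - y)) has_contour_integral 2 * pi * \<i> * u y) ?\<gamma>"
      using winding_number_ellipse_path[OF assms(1) y] by simp
    have "((\<lambda>z. u z / poly q z / (z - y)) has_contour_integral J y) ?\<gamma>"
      unfolding J_def using q ne
      by (intro has_contour_integral_integral contour_integrable_ellipse_path continuous_intros contu)
         auto
    from has_contour_integral_diff[OF C has_contour_integral_lmul[OF this, of "poly q y"]]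
    \<comment> \<open>The integrand is u(z)/q(z) times the divided difference of q. Its integral is
      evaluated here by Cauchy's formula and in fact 2 by expansion in powers of y; equating the
      values gives the remainder formula for \<open>K\<close>.\<close>
    have 1: "((\<lambda>z. u z / (z - y) - poly q y * (u z / poly q z / (z - y))) has_contour_integral
        2 * pi * \<i> * u y - poly q y * J y) ?\<gamma>" .
    have "((\<lambda>z. u z / poly q z * c j z) has_contour_integral I j) ?\<gamma>" for j
      unfolding I_def c_def using q
      by (intro has_contour_integral_integral contour_integrable_ellipse_path continuous_intros contu)
         auto
    then have "((\<lambda>z. \<Sum>j<Suc N. y ^ j * (u z / poly q z * c j z)) has_contour_integral
        (\<Sum>j<Suc N. y ^ j * I j)) ?\<gamma>"
      by (intro has_contour_integral_sum has_contour_integral_lmul) auto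
    then have 2: "((\<lambda>z. u z / (z - y) - poly q y * (u z / poly q z / (z - y))) has_contour_integral
        (\<Sum>j<Suc N. y ^ j * I j)) ?\<gamma>"
    proof (rule has_contour_integral_eq)
      fix z assume "z \<in> path_image ?\<gamma>"
      then have z: "z \<in> ellipse \<rho>" by (simp add: path_image_ellipse_path)
      have "poly q y - poly q z = (y - z) * (\<Sum>j<Suc N. c j z * y ^ j)"
        unfolding qsum c_def by (rule polyfun_diff) simp
      then have d: "(\<Sum>j<Suc N. c j z * y ^ j) = (poly q z - poly q y) / (z - y)"
        using ne[OF z] by (simp add: field_simps)
      have "(\<Sum>j<Suc N. y ^ j * (u z / poly q z * c j z))
          = u z / poly q z * (\<Sum>j<Suc N. c j z * y ^ j)"
        unfolding sum_distrib_left by (intro sum.cong) (auto simp: mult_ac)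
      also have "\<dots> = u z / (z - y) - poly q y * (u z / poly q z / (z - y))"
        unfolding d using q[OF z] ne[OF z] by (simp add: diff_divide_distrib right_diff_distrib)
      finally show "(\<Sum>j<Suc N. y ^ j * (u z / poly q z * c j z))
          = u z / (z - y) - poly q y * (u z / poly q z / (z - y))" .
    qed
    have "2 * pi * \<i> * u y - poly q y * J y = (\<Sum>j<Suc N. y ^ j * I j)"
      by (rule has_contour_integral_unique[OF 1 2])
    also have "\<dots> = 2 * pi * \<i> * poly K y"
      unfolding K_def poly_sum poly_monom sum_distrib_left by (intro sum.cong) auto
    finally show ?thesis by (simp add: field_simps)
  qed
  have "degree K \<le> N"
    unfolding K_def by (intro degree_sum_le) (auto intro: order_trans[OF degree_monom_le])
  moreover have "poly K a = poly P a" if "a \<in> A" for a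
    using K[of a] A(1) that root[OF that] interp[OF that] by auto
  ultimately have "K = P" using P A(2) by (intro poly_eqI_degree[of A]) auto
  with K[OF x] show ?thesis by (simp add: J_def)
qed

text \<open>The remainder formula holds on an open set, so it can be differentiated by the product
  rule. The first derivative is computed on all of \<open>S\<close>, because the second one
  differentiates that formula again.\<close>

lemma interpolation_remainder_derivs:
  fixes P q :: "complex poly"
  assumes "\<rho> > 1" and g: "continuous_on (ellipse \<rho>) g"
  defines "S \<equiv> interior (ellipse_region \<rho>)"
    and "G \<equiv> \<lambda>k x. contour_integral (ellipse_path \<rho>) (\<lambda>z. g z / (z - x) ^ k) / (2 * pi * \<i>)"
  assumes rem: "\<And>x. x \<in> S \<Longrightarrow> u x - poly P x = poly q x * G 1 x"
    and x: "x \<in> S"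
  shows "deriv u x - poly (pderiv P) x = poly (pderiv q) x * G 1 x + poly q x * G 2 x"
    and "deriv (deriv u) x - poly (pderiv (pderiv P)) x
      = poly (pderiv (pderiv q)) x * G 1 x + 2 * (poly (pderiv q) x * G 2 x) + 2 * (poly q x * G 3 x)"
proof -
  have S: "open S" by (simp add: S_def)
  have G: "(G k has_field_derivative of_nat k * G (Suc k) y) (at y)" if "y \<in> S" "k \<noteq> 0" for y k
    using DERIV_cdivide[OF has_field_derivative_cauchy_integral_ellipse[OF assms(1) g that(2)
        that(1)[unfolded S_def]], of "2 * pi * \<i>"]
    by (simp add: G_def)
  note G1 = G[of _ 1, simplified] and G2 = G[of _ 2, simplified]
  have d1: "deriv u y = poly (pderiv P) y + poly (pderiv q) y * G 1 y + poly q y * G 2 y"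
    if y: "y \<in> S" for y
  proof (rule DERIV_imp_deriv)
    have "((\<lambda>x. poly P x + poly q x * G 1 x) has_field_derivative
        poly (pderiv P) y + (poly (pderiv q) y * G 1 y + G 2 y * poly q y)) (at y)"
      using G1[OF y] by (intro DERIV_add DERIV_mult poly_DERIV) (simp add: numeral_2_eq_2)
    then have "(u has_field_derivative
        poly (pderiv P) y + (poly (pderiv q) y * G 1 y + G 2 y * poly q y)) (at y)"
      using S y by (rule has_field_derivative_transform_within_open)
        (use rem in \<open>simp add: algebra_simps\<close>)
    then show "(u has_field_derivative
        poly (pderiv P) y + poly (pderiv q) y * G 1 y + poly q y * G 2 y) (at y)"
      by (simp add: algebra_simps)
  qed
  then show "deriv u x - poly (pderiv P) x = poly (pderiv q) x * G 1 x + poly q x * G 2 x"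
    using x by simp
  have "((\<lambda>y. poly (pderiv P) y + poly (pderiv q) y * G 1 y + poly q y * G 2 y) has_field_derivative
      poly (pderiv (pderiv P)) x
      + (poly (pderiv (pderiv q)) x * G 1 x + G 2 x * poly (pderiv q) x)
      + (poly (pderiv q) x * G 2 x + (2 * G 3 x) * poly q x)) (at x)"
    using G1[OF x] G2[OF x]
    by (intro DERIV_add DERIV_mult poly_DERIV) (simp_all add: numeral_2_eq_2 numeral_3_eq_3)
  then have "(deriv u has_field_derivative
      poly (pderiv (pderiv P)) x
      + (poly (pderiv (pderiv q)) x * G 1 x + G 2 x * poly (pderiv q) x)
      + (poly (pderiv q) x * G 2 x + (2 * G 3 x) * poly q x)) (at x)"
    using S x by (rule has_field_derivative_transform_within_open) (use d1 in simp)
  then show "deriv (deriv u) x - poly (pderiv (pderiv P)) x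
      = poly (pderiv (pderiv q)) x * G 1 x + 2 * (poly (pderiv q) x * G 2 x) + 2 * (poly q x * G 3 x)"
    by (simp add: DERIV_imp_deriv algebra_simps)
qed

text \<open>Each factor 1/(z - x) costs at most 1/D, as D bounds the distance from the ellipse to
  [-1,1] from below; the rest is the length estimate.\<close>

lemma norm_cauchy_integral_ellipse_le:
  assumes "\<rho> > 1" "x \<in> {-1..1::real}" and g: "continuous_on (ellipse \<rho>) g"
    and B: "\<And>z. z \<in> ellipse \<rho> \<Longrightarrow> cmod (g z) \<le> B"
  shows "cmod (contour_integral (ellipse_path \<rho>) (\<lambda>z. g z / (z - of_real x) ^ k) / (2 * pi * \<i>))
    \<le> B * L_const \<rho> / (2 * pi) / D_const \<rho> ^ k"
proof -
  note D = D_const_pos[OF assms(1)]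
  have d: "D_const \<rho> \<le> cmod (z - of_real x)" if "z \<in> ellipse \<rho>" for z
    using dist_ellipse_real_ge[OF assms(1,2) that] .
  have "cmod (contour_integral (ellipse_path \<rho>) (\<lambda>z. g z / (z - of_real x) ^ k))
      \<le> B / D_const \<rho> ^ k * L_const \<rho>"
  proof (rule norm_contour_integral_ellipse_le)
    show "continuous_on (ellipse \<rho>) (\<lambda>z. g z / (z - of_real x) ^ k)"
      using d D by (intro continuous_intros g) fastforce
    fix z assume z: "z \<in> ellipse \<rho>"
    have "D_const \<rho> ^ k \<le> cmod (z - of_real x) ^ k"
      using d[OF z] D by (intro power_mono) auto
    then show "cmod (g z / (z - of_real x) ^ k) \<le> B / D_const \<rho> ^ k"
      unfolding norm_divide norm_power using B[OF z] D
      by (intro frac_le) (auto intro: order_trans[OF norm_ge_zero])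
  qed
  then have "cmod (contour_integral (ellipse_path \<rho>) (\<lambda>z. g z / (z - of_real x) ^ k)) / (2 * pi)
      \<le> B / D_const \<rho> ^ k * L_const \<rho> / (2 * pi)"
    by (rule divide_right_mono) simp
  then show ?thesis by (simp add: norm_divide norm_mult mult_ac)
qed

section \<open>Error bounds on [-1,1] and at the zeros of T' and T''\<close>

theorem theorem2p1:
  fixes N :: nat and \<rho> :: real and u :: "complex \<Rightarrow> complex" and u\<^sub>N :: "complex poly"
  assumes "N \<ge> 1" and "\<rho> > 1"
    and "u analytic_on ellipse_region \<rho>"
    and "degree u\<^sub>N \<le> N"
    and "\<And>x. x \<in> {-1..1} \<Longrightarrow> poly (chebyshev_T (N + 1)) x = 0 \<Longrightarrow>
           poly u\<^sub>N (complex_of_real x) = u (complex_of_real x)"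
  shows
    "(\<forall>x\<in>{-1..1::real}. cmod (u x - poly u\<^sub>N x)
       \<le> C_const \<rho> u * L_const \<rho> / (pi * D_const \<rho>)
          * (1 / (\<rho> ^ (N + 1) - 1 / \<rho> ^ (N + 1))))
   \<and> (\<forall>x\<in>{-1..1::real}. cmod (deriv u x - poly (pderiv u\<^sub>N) x)
       \<le> C_const \<rho> u * L_const \<rho> / (pi * D_const \<rho>)
          * ((real N + 1)\<^sup>2 + 1 / D_const \<rho>)
          * (1 / (\<rho> ^ (N + 1) - 1 / \<rho> ^ (N + 1))))
   \<and> (\<forall>x\<in>{-1..1::real}. cmod (deriv (deriv u) x - poly (pderiv (pderiv u\<^sub>N)) x)
       \<le> C_const \<rho> u * L_const \<rho> / pi
          * (real N * (real N + 1)\<^sup>2 * (real N + 2) / (3 * D_const \<rho>)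
             + 2 * (real N + 1)\<^sup>2 / (D_const \<rho>)\<^sup>2 + 2 / (D_const \<rho>) ^ 3)
          * (1 / (\<rho> ^ (N + 1) - 1 / \<rho> ^ (N + 1))))
   \<and> (bij_betw (\<lambda>j. cos (real j * pi / (real N + 1))) {1..N}
       {x. poly (pderiv (chebyshev_T (N + 1))) x = 0})
   \<and> (\<forall>j\<in>{1..N}. let t = cos (real j * pi / (real N + 1)) in
       cmod (deriv u t - poly (pderiv u\<^sub>N) t)
       \<le> C_const \<rho> u * L_const \<rho> / (pi * (D_const \<rho>)\<^sup>2)
          * (1 / (\<rho> ^ (N + 1) - 1 / \<rho> ^ (N + 1))))
   \<and> (card {\<tau>. poly (pderiv (pderiv (chebyshev_T (N + 1)))) \<tau> = 0} = N - 1)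
   \<and> ({\<tau>. poly (pderiv (pderiv (chebyshev_T (N + 1)))) \<tau> = 0}
       = cos ` {\<theta>. 0 < \<theta> \<and> \<theta> < pi \<and>
           (real N + 1) * cos ((real N + 1) * \<theta>) * sin \<theta> = sin ((real N + 1) * \<theta>) * cos \<theta>})
   \<and> (\<forall>\<tau>. poly (pderiv (pderiv (chebyshev_T (N + 1)))) \<tau> = 0 \<longrightarrow>
       cmod (deriv (deriv u) \<tau> - poly (pderiv (pderiv u\<^sub>N)) \<tau>)
       \<le> 2 * C_const \<rho> u * L_const \<rho> / (pi * (D_const \<rho>)\<^sup>2)
          * ((real N + 1)\<^sup>2 + 1 / D_const \<rho>)
          * (1 / (\<rho> ^ (N + 1) - 1 / \<rho> ^ (N + 1))))"
proof -
  define n where "n = N + 1"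
  define q where "q = map_poly complex_of_real (chebyshev_T n)"
  define E where "E = 1 / (\<rho> ^ n - 1 / \<rho> ^ n)"
  define D where "D = D_const \<rho>"
  \<comment> \<open>The common factor of all five bounds. The 2 in the denominator 2 pi cancels
    against the 2 in \<open>2 * E\<close>, which bounds 1/|T| on the ellipse.\<close>
  define M where "M = C_const \<rho> u * L_const \<rho> / pi * E"
  define G where "G = (\<lambda>k x. contour_integral (ellipse_path \<rho>)
    (\<lambda>z. u z / poly q z / (z - x) ^ k) / (2 * pi * \<i>))"
  let ?S = "interior (ellipse_region \<rho>)"
  have D: "D > 0" unfolding D_def by (rule D_const_pos) fact
  have "\<rho> ^ n > 1" unfolding n_def using assms(2) by (intro one_less_power) auto
  then have "1 / \<rho> ^ n < 1" by simp
  with \<open>\<rho> ^ n > 1\<close> have E: "\<rho> ^ n - 1 / \<rho> ^ n > 0" by linarith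
  have hol: "u holomorphic_on ellipse_region \<rho>"
    using assms(3) by (rule analytic_imp_holomorphic)
  have contu: "continuous_on (ellipse \<rho>) u"
    using holomorphic_on_imp_continuous_on[OF hol]
    by (rule continuous_on_subset) (simp add: ellipse_region_def)
  have C: "cmod (u z) \<le> C_const \<rho> u" if "z \<in> ellipse \<rho>" for z
    using C_const_attained[OF contu] that by force
  have q_ge: "(\<rho> ^ n - 1 / \<rho> ^ n) / 2 \<le> cmod (poly q z)" if "z \<in> ellipse \<rho>" for z
    unfolding q_def by (rule norm_chebyshev_T_ellipse_ge[OF assms(2) that])
  have q_nz: "poly q z \<noteq> 0" if "z \<in> ellipse \<rho>" for z
    using q_ge[OF that] E by auto
  have contg: "continuous_on (ellipse \<rho>) (\<lambda>z. u z / poly q z)"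
    using q_nz by (intro continuous_intros contu) auto
  have g_le: "cmod (u z / poly q z) \<le> C_const \<rho> u * (2 * E)" if z: "z \<in> ellipse \<rho>" for z
  proof -
    have "cmod (u z / poly q z) \<le> C_const \<rho> u / ((\<rho> ^ n - 1 / \<rho> ^ n) / 2)"
      unfolding norm_divide using C[OF z] q_ge[OF z] E
      by (intro frac_le) (auto intro: order_trans[OF norm_ge_zero])
    then show ?thesis by (simp add: E_def)
  qed
  have G_le: "cmod (G k (of_real x)) \<le> M / D ^ k" if "x \<in> {-1..1}" for x :: real and k
    using norm_cauchy_integral_ellipse_le[OF assms(2) that contg g_le, of k]
    by (simp add: G_def M_def D_def mult_ac)

  \<comment> \<open>The interpolation nodes as complex numbers. There are at least N+1 of them,
    enough to determine a polynomial of degree at most N.\<close>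
  define A where "A = complex_of_real ` {x \<in> {-1..1}. poly (chebyshev_T n) x = 0}"
  have "N < card A"
    using chebyshev_T_roots_card[of n] by (simp add: A_def card_image inj_on_def n_def)
  moreover have "A \<subseteq> ?S"
    using real_in_interior_ellipse_region[OF assms(2)] by (auto simp: A_def)
  moreover have "degree q \<le> Suc N"
    using map_poly_degree_leq[of complex_of_real "chebyshev_T n"] degree_chebyshev_T[of n]
    by (simp add: q_def n_def)
  ultimately have rem: "u x - poly u\<^sub>N x = poly q x * G 1 x" if "x \<in> ?S" for x
    unfolding G_def power_one_right using assms(4,5) that
    by (intro interpolation_remainder[where A = A] assms(2) hol q_nz)
       (auto simp: A_def q_def n_def poly_map_poly_of_real)
  have real_S: "complex_of_real x \<in> ?S" if "x \<in> {-1..1}" for x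
    by (rule real_in_interior_ellipse_region[OF assms(2) that])
  have derivs: "deriv u (of_real x) - poly (pderiv u\<^sub>N) (of_real x)
      = poly (pderiv q) (of_real x) * G 1 (of_real x) + poly q (of_real x) * G 2 (of_real x)"
    "deriv (deriv u) (of_real x) - poly (pderiv (pderiv u\<^sub>N)) (of_real x)
      = poly (pderiv (pderiv q)) (of_real x) * G 1 (of_real x)
        + 2 * (poly (pderiv q) (of_real x) * G 2 (of_real x)) + 2 * (poly q (of_real x) * G 3 (of_real x))"
    if "x \<in> {-1..1}" for x
    unfolding G_def
    by (rule interpolation_remainder_derivs[OF assms(2) contg rem[unfolded G_def] real_S[OF that]],
        assumption)+

  let ?T = "chebyshev_T n"
  have qx: "poly q (of_real x) = of_real (poly ?T x)"
    "poly (pderiv q) (of_real x) = of_real (poly (pderiv ?T) x)"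
    "poly (pderiv (pderiv q)) (of_real x) = of_real (poly (pderiv (pderiv ?T)) x)" for x
    by (simp_all add: q_def pderiv_map_poly_of_real poly_map_poly_of_real)
  have term_le: "cmod (of_real t * G k (of_real x)) \<le> b * (M / D ^ k)"
    if "x \<in> {-1..1}" "\<bar>t\<bar> \<le> b" for x t b :: real and k
    unfolding norm_mult norm_of_real using that G_le[OF that(1)] by (intro mult_mono) auto
  have T0: "cmod (of_real (poly ?T x) * G k (of_real x)) \<le> 1 * (M / D ^ k)"
    and T1: "cmod (of_real (poly (pderiv ?T) x) * G k (of_real x)) \<le> (real n)\<^sup>2 * (M / D ^ k)"
    and T2: "cmod (of_real (poly (pderiv (pderiv ?T)) x) * G k (of_real x))
      \<le> (real n)\<^sup>2 * ((real n)\<^sup>2 - 1) / 3 * (M / D ^ k)"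
    if "x \<in> {-1..1}" for x k
    using that by (intro term_le abs_chebyshev_T_le_1 abs_pderiv_chebyshev_T_le
        abs_pderiv2_chebyshev_T_le; assumption)+
  have tri3: "cmod (a + 2 * b + 2 * c) \<le> cmod a + 2 * cmod b + 2 * cmod c" for a b c
    by (intro norm_add_rule_thm) (auto simp: norm_mult)

  have b0: "cmod (u x - poly u\<^sub>N x) \<le> M / D" if "x \<in> {-1..1::real}" for x
    using T0[OF that, of 1] rem[OF real_S[OF that]] by (simp add: qx)
  have b1: "cmod (deriv u x - poly (pderiv u\<^sub>N) x) \<le> (real n)\<^sup>2 * (M / D) + M / D\<^sup>2"
    if "x \<in> {-1..1::real}" for x
    using norm_triangle_mono[OF T1[OF that, of 1] T0[OF that, of 2]] by (simp add: derivs[OF that] qx)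
  have b2: "cmod (deriv (deriv u) x - poly (pderiv (pderiv u\<^sub>N)) x)
      \<le> (real n)\<^sup>2 * ((real n)\<^sup>2 - 1) / 3 * (M / D) + 2 * ((real n)\<^sup>2 * (M / D\<^sup>2)) + 2 * (M / D ^ 3)"
    if x: "x \<in> {-1..1::real}" for x
    unfolding derivs[OF x] qx
    using T2[OF x, of 1] T1[OF x, of 2] T0[OF x, of 3] by (intro order_trans[OF tri3] add_mono) auto
  \<comment> \<open>At a zero of T' the G_1 term of the first derivative of the error vanishes;
    likewise, in \<open>b2'\<close>, a zero of T'' removes the G_1 term of the second.\<close>
  have b1': "cmod (deriv u x - poly (pderiv u\<^sub>N) x) \<le> M / D\<^sup>2"
    if "x \<in> {-1..1::real}" "poly (pderiv ?T) x = 0" for x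
    using T0[OF that(1), of 2] by (simp add: derivs[OF that(1)] qx that(2))
  have b2': "cmod (deriv (deriv u) x - poly (pderiv (pderiv u\<^sub>N)) x)
      \<le> 2 * ((real n)\<^sup>2 * (M / D\<^sup>2)) + 2 * (M / D ^ 3)"
    if x: "x \<in> {-1..1::real}" "poly (pderiv (pderiv ?T)) x = 0" for x
    unfolding derivs[OF x(1)] qx x(2)
    using T1[OF x(1), of 2] T0[OF x(1), of 3] by (intro order_trans[OF tri3]) auto

  have node: "poly (pderiv ?T) (cos (real j * pi / (real N + 1))) = 0" if "j \<in> {1..N}" for j
    using bij_betw_apply[OF bij_betw_roots_pderiv_chebyshev_T that] by (simp add: n_def)
  have node2: "\<tau> \<in> {-1..1}" if "poly (pderiv (pderiv ?T)) \<tau> = 0" for \<tau>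
    using roots_pderiv2_chebyshev_T(2)[OF assms(1)] that by (force simp: n_def)
  have n: "real n = real N + 1" by (simp add: n_def)
  have e0: "M / D = C_const \<rho> u * L_const \<rho> / (pi * D) * E" by (simp add: M_def)
  have e1: "(real n)\<^sup>2 * (M / D) + M / D\<^sup>2
      = C_const \<rho> u * L_const \<rho> / (pi * D) * ((real N + 1)\<^sup>2 + 1 / D) * E"
    unfolding n M_def by (simp add: power2_eq_square algebra_simps add_divide_distrib)
  \<comment> \<open>With n = N+1 the factor n^2 - 1 is N(N+2), which turns the bound for T'' into
    the stated coefficient.\<close>
  have "(real n)\<^sup>2 * ((real n)\<^sup>2 - 1) = real N * (real N + 1)\<^sup>2 * (real N + 2)"
    unfolding n by (simp add: power2_eq_square algebra_simps)
  then have e2: "(real n)\<^sup>2 * ((real n)\<^sup>2 - 1) / 3 * (M / D) + 2 * ((real n)\<^sup>2 * (M / D\<^sup>2)) + 2 * (M / D ^ 3)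
      = C_const \<rho> u * L_const \<rho> / pi
          * (real N * (real N + 1)\<^sup>2 * (real N + 2) / (3 * D) + 2 * (real N + 1)\<^sup>2 / D\<^sup>2 + 2 / D ^ 3) * E"
    unfolding n M_def by (simp add: ring_distribs mult_ac add_divide_distrib)
  have e1': "M / D\<^sup>2 = C_const \<rho> u * L_const \<rho> / (pi * D\<^sup>2) * E" by (simp add: M_def)
  have e2': "2 * ((real n)\<^sup>2 * (M / D\<^sup>2)) + 2 * (M / D ^ 3)
      = 2 * C_const \<rho> u * L_const \<rho> / (pi * D\<^sup>2) * ((real N + 1)\<^sup>2 + 1 / D) * E"
    unfolding n M_def by (simp add: ring_distribs mult_ac add_divide_distrib power2_eq_square power3_eq_cube)
  show ?thesis
    unfolding Let_def D_def[symmetric] n_def[symmetric] E_def[symmetric]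
    by (intro conjI ballI allI impI b0[unfolded e0] b1[unfolded e1] b2[unfolded e2]
        b1'[unfolded e1'] b2'[OF node2, unfolded e2'] node bij_betw_roots_pderiv_chebyshev_T[of N, folded n_def]
        roots_pderiv2_chebyshev_T(1)[OF assms(1), folded n_def]
        roots_pderiv2_chebyshev_T_eq[OF assms(1), folded n_def])
       (use cos_ge_minus_one cos_le_one in auto)
qed

end
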